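(* Let $G_n=(V_n,E_n)$ be a sequence of finite simple connected graphs with at least two vertices, and let $t^{\mathrm{IP}}_{\mathrm{mix}}(G_n)$ denote the total variation mixing time of the discrete time ($\frac12$-lazy) interchange process over $G_n$. (i) Suppose that there exists $K<\infty$ such that, for all $n$ large enough, there exists $W_n\subset V_n$ with $$1\le|W_n|\le K\qquad\text{and}\qquad |\partial_E W_n|\le\frac{K\,|E_n|}{t^{\mathrm{IP}}_{\mathrm{mix}}(G_n)} .$$ Then the product condition does not hold for the sequence of interchange processes over $G_n$; that is, $(1-\lambda_2^{(n)})\,t^{\mathrm{IP}}_{\mathrm{mix}}(G_n)$ does not tend to infinity. (ii) There cannot exist a sequence of subsets $W_n\subset V_n$ with $|W_n|\to\infty$, $|W_n|<|V_n|/2$, and $|\partial_E W_n|=O(|E_n|)/t^{\mathrm{IP}}_{\mathrm{mix}}(G_n)$ (i.e. $|\partial_E W_n|\le C|E_n|/t^{\mathrm{IP}}_{\mathrm{mix}}(G_n)$ for all $n$, for some constant $C<\infty$).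
   Context: For $S\subset V_n$, $\partial_E S$ is the set of edges of $G_n$ connecting $S$ with its complement. For a connected finite graph $G=(V,E)$ on $N$ vertices, the discrete time $\frac12$-lazy interchange process is the Markov chain on the symmetric group $S_N$ (permutations of $V$) in which at each step, with probability $1/2$, nothing happens, and with probability $1/2$ an edge $(v_1,v_2)\in E$ is selected uniformly at random and the current permutation is multiplied by the transposition $(v_1v_2)$ (the labelled particles at the endpoints are swapped). Its stationary distribution $\pi$ is uniform on $S_N$. Total variation distance: $\|\mu-\nu\|=\max_A|\mu(A)-\nu(A)|$; $d(t)=\max_x\|P^t(x,\cdot)-\pi\|$; $t_{\mathrm{mix}}(\varepsilon)=\inf\{t>0:d(t)<\varepsilon\}$; and $t_{\mathrm{mix}}=t_{\mathrm{mix}}(1/4)$ when no argument is written. The number $\lambda_2^{(n)}$ is the second largest eigenvalue of the transition matrix of the interchange process over $G_n$, and the product condition is $(1-\lambda_2^{(n)})\,t^{\mathrm{IP}}_{\mathrm{mix}}(G_n)\to\infty$ as $n\to\infty$. *)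

theory Defs
  imports
    "HOL-Probability.Probability_Mass_Function"
    "HOL-Combinatorics.Permutations"
    "Jordan_Normal_Form.Char_Poly"
begin

section \<open>Finite simple graphs\<close>

text \<open>An edge is the two-element set of its endpoints.\<close>

definition simple_graph :: "'a set \<Rightarrow> 'a set set \<Rightarrow> bool" where
  "simple_graph V E \<longleftrightarrow> finite V \<and> (\<forall>e\<in>E. e \<subseteq> V \<and> card e = 2)"

definition connected_graph :: "'a set \<Rightarrow> 'a set set \<Rightarrow> bool" where
  "connected_graph V E \<longleftrightarrow> V \<noteq> {} \<and> (\<forall>u\<in>V. \<forall>v\<in>V. (u, v) \<in> {(x, y). {x, y} \<in> E}\<^sup>*)"

definition edge_boundary :: "'a set \<Rightarrow> 'a set set \<Rightarrow> 'a set \<Rightarrow> 'a set set" where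
  "edge_boundary V E S = {e \<in> E. \<exists>u\<in>S. \<exists>v\<in>V - S. e = {u, v}}"


section \<open>Finite Markov chains\<close>

text \<open>
  A Markov chain on a finite state space \<open>\<Omega>\<close> is given by its transition kernel
  \<open>P :: 's \<Rightarrow> 's pmf\<close>, so that \<open>pmf (P x) y\<close> is the transition probability from \<open>x\<close> to \<open>y\<close>.
  Only the values of the kernel on \<open>\<Omega>\<close> matter.
\<close>

primrec chain_law :: "('s \<Rightarrow> 's pmf) \<Rightarrow> nat \<Rightarrow> 's \<Rightarrow> 's pmf" where
  "chain_law P 0 x = return_pmf x"
| "chain_law P (Suc t) x = bind_pmf (chain_law P t x) P"

definition tv_dist :: "'s pmf \<Rightarrow> 's pmf \<Rightarrow> real" where
  "tv_dist \<mu> \<nu> = (SUP A. \<bar>measure_pmf.prob \<mu> A - measure_pmf.prob \<nu> A\<bar>)"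

definition worst_tv :: "'s set \<Rightarrow> ('s \<Rightarrow> 's pmf) \<Rightarrow> 's pmf \<Rightarrow> nat \<Rightarrow> real" where
  "worst_tv \<Omega> P \<pi> t = (MAX x\<in>\<Omega>. tv_dist (chain_law P t x) \<pi>)"

definition mixing_time :: "'s set \<Rightarrow> ('s \<Rightarrow> 's pmf) \<Rightarrow> 's pmf \<Rightarrow> real \<Rightarrow> nat" where
  "mixing_time \<Omega> P \<pi> \<epsilon> = Inf {t. t > 0 \<and> worst_tv \<Omega> P \<pi> t < \<epsilon>}"

definition transition_matrix :: "'s list \<Rightarrow> ('s \<Rightarrow> 's pmf) \<Rightarrow> real mat" where
  "transition_matrix xs P = mat (length xs) (length xs) (\<lambda>(i, j). pmf (P (xs ! i)) (xs ! j))"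

text \<open>
  The second largest eigenvalue, counting eigenvalues with multiplicity: the entry of index 1 in
  the decreasing list of the real roots of the characteristic polynomial. The chosen enumeration
  of \<open>\<Omega>\<close> is immaterial, since another one conjugates the matrix by a permutation matrix. The
  definition is meant for reversible chains with at least two states, whose characteristic
  polynomial splits over the reals.
\<close>

definition second_eigenvalue :: "'s set \<Rightarrow> ('s \<Rightarrow> 's pmf) \<Rightarrow> real" where
  "second_eigenvalue \<Omega> P =
     (let xs = (SOME xs. set xs = \<Omega> \<and> distinct xs)
      in rev (sorted_list_of_multiset (proots (char_poly (transition_matrix xs P)))) ! 1)"


section \<open>The lazy interchange process\<close>

definition edge_swap :: "'a set \<Rightarrow> 'a \<Rightarrow> 'a" where
  "edge_swap e = (THE \<tau>. \<exists>u v. e = {u, v} \<and> \<tau> = Transposition.transpose u v)"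

lemma edge_swap_doubleton: "edge_swap {u, v} = Transposition.transpose u v"
  unfolding edge_swap_def
  by (rule the_equality) (auto simp: doubleton_eq_iff transpose_commute)

definition perms :: "'a set \<Rightarrow> ('a \<Rightarrow> 'a) set" where
  "perms V = {p. p permutes V}"

text \<open>
  In a state \<open>p\<close>, the particle located at the vertex \<open>v\<close> has label \<open>p v\<close>. Swapping the particles
  at the endpoints of an edge is thus multiplication by the transposition on the right.
\<close>

definition interchange_step :: "'a set set \<Rightarrow> ('a \<Rightarrow> 'a) \<Rightarrow> ('a \<Rightarrow> 'a) pmf" where
  "interchange_step E p =
     bind_pmf (bernoulli_pmf (1 / 2)) (\<lambda>lazy.
       if lazy then return_pmf p
       else map_pmf (\<lambda>e. p \<circ> edge_swap e) (pmf_of_set E))"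

definition t_mix_IP :: "'a set \<Rightarrow> 'a set set \<Rightarrow> nat" where
  "t_mix_IP V E =
     mixing_time (perms V) (interchange_step E) (pmf_of_set (perms V)) (1 / 4)"

definition lambda2_IP :: "'a set \<Rightarrow> 'a set set \<Rightarrow> real" where
  "lambda2_IP V E = second_eigenvalue (perms V) (interchange_step E)"

definition product_condition :: "(nat \<Rightarrow> 'a set) \<Rightarrow> (nat \<Rightarrow> 'a set set) \<Rightarrow> bool" where
  "product_condition V E \<longleftrightarrow>
     filterlim (\<lambda>n. (1 - lambda2_IP (V n) (E n)) * real (t_mix_IP (V n) (E n)))
       at_top sequentially"

end

theory Submission
  imports Defs
begin

text \<open>
  For (i), the indicator of the event that a fixed particle \<open>a\<close> sits in \<open>W\<close> has variance of order
  \<open>|W| / |V|\<close> and Dirichlet form at most \<open>|\<partial>W| / (2 |E| |V|)\<close>, so the spectral gap is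
  \<open>O(|\<partial>W| / |E|) = O(1 / t)\<close> unless \<open>W = V\<close>; in that case \<open>|V| \<le> K\<close> and the mixing
  time itself is bounded by Doeblin minorization. That the gap is at most the Rayleigh quotient of any
  mean-zero function needs no diagonalisation: a maximiser of the quadratic form on the unit sphere of
  mean-zero functions is an eigenvector, and irreducibility makes its eigenvalue differ from \<open>1\<close>.

  For (ii), let \<open>Y p\<close> be the number of sites of \<open>W\<close> occupied by particles that do not belong to
  \<open>W\<close>. Started from the identity, a step raises the mean of \<open>Y\<close> by at most \<open>|\<partial>W| / (2 |E|)\<close>,
  so at the mixing time this mean is \<open>O(1)\<close>, whereas under the uniform law \<open>Y \<ge> |W| / 4\<close> has
  probability above \<open>1/3\<close>.
\<close>

section \<open>Variational bound for the spectral gap\<close>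

text \<open>The constant function and \<open>g\<close> make \<open>1\<close> and
  \<open>\<mu>\<close> roots of the characteristic polynomial. Being distinct, they occupy different
  places in the decreasing list of roots, so at least one of them stands at a positive index and
  bounds the entry of index 1 from below.\<close>

lemma second_eigenvalue_ge:
  fixes \<Omega> :: "'s set"
  assumes fin: "finite \<Omega>" and ne: "\<mu> \<noteq> (1::real)"
    and one: "\<And>x. x \<in> \<Omega> \<Longrightarrow> (\<Sum>y\<in>\<Omega>. pmf (P x) y) = 1"
    and eig: "\<And>x. x \<in> \<Omega> \<Longrightarrow> (\<Sum>y\<in>\<Omega>. pmf (P x) y * g y) = \<mu> * g x"
    and nz: "x0 \<in> \<Omega>" "g x0 \<noteq> 0"
  shows "min 1 \<mu> \<le> second_eigenvalue \<Omega> P"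
proof -
  define xs where "xs = (SOME xs. set xs = \<Omega> \<and> distinct xs)"
  have xs: "set xs = \<Omega>" "distinct xs"
    using someI_ex[OF finite_distinct_list[OF fin]] unfolding xs_def by auto
  define n where "n = length xs"
  define A where "A = transition_matrix xs P"
  have A: "A \<in> carrier_mat n n"
    by (simp add: A_def n_def transition_matrix_def)
  have root: "poly (char_poly A) k = 0"
    if h: "\<And>x. x \<in> \<Omega> \<Longrightarrow> (\<Sum>y\<in>\<Omega>. pmf (P x) y * h y) = k * h x" and "h x0 \<noteq> 0" for h k
  proof -
    obtain i0 where i0: "i0 < n" "xs ! i0 = x0"
      using nz(1) xs(1) by (auto simp: in_set_conv_nth n_def)
    let ?v = "vec n (\<lambda>i. h (xs ! i))"
    have "vec_index ?v i0 \<noteq> vec_index (0\<^sub>v n) i0"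
      using i0 that(2) by simp
    then have "?v \<noteq> 0\<^sub>v n"
      by metis
    moreover have "A *\<^sub>v ?v = k \<cdot>\<^sub>v ?v"
    proof (rule eq_vecI)
      fix i assume "i < dim_vec (k \<cdot>\<^sub>v ?v)"
      then have i: "i < n" by simp
      have "vec_index (A *\<^sub>v ?v) i = (\<Sum>j<n. pmf (P (xs ! i)) (xs ! j) * h (xs ! j))"
        using i by (simp add: A_def transition_matrix_def n_def scalar_prod_def lessThan_atLeast0)
      also have "\<dots> = (\<Sum>y\<in>\<Omega>. pmf (P (xs ! i)) y * h y)"
        by (rule sum.reindex_bij_betw) (use xs in \<open>auto simp: n_def intro!: bij_betw_nth\<close>)
      finally show "vec_index (A *\<^sub>v ?v) i = vec_index (k \<cdot>\<^sub>v ?v) i"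
        using i h[of "xs ! i"] xs(1) by (auto simp: n_def)
    qed (use A in auto)
    ultimately have "eigenvalue A k"
      using A unfolding eigenvalue_def eigenvector_def by (intro exI[of _ ?v]) auto
    then show ?thesis
      using eigenvalue_root_char_poly[OF A] by simp
  qed
  have "char_poly A \<noteq> 0"
    using degree_monic_char_poly[OF A] by auto
  define M where "M = proots (char_poly A)"
  have in_M: "1 \<in># M" "\<mu> \<in># M"
    using root[of "\<lambda>_. 1" 1] root[of g \<mu>] one eig nz \<open>char_poly A \<noteq> 0\<close>
    by (auto simp: M_def)
  define L where "L = rev (sorted_list_of_multiset M)"
  have L: "set L = set_mset M" "sorted_wrt (\<ge>) L"
    by (auto simp: L_def sorted_wrt_rev)
  obtain i j where ij: "i < length L" "L ! i = 1" "j < length L" "L ! j = \<mu>"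
    using in_M L(1) by (metis in_set_conv_nth)
  then have "i \<noteq> j" using ne by auto
  \<comment> \<open>At most one of \<open>i\<close> and \<open>j\<close> is the head of the list;
    the other is dominated by the entry of index 1.\<close>
  have desc: "L ! k \<le> L ! 1" if "0 < k" "k < length L" for k
  proof (cases "k = 1")
    case False
    then show ?thesis
      using sorted_wrt_nth_less[OF L(2), of 1 k] that by auto
  qed simp
  have "min 1 \<mu> \<le> L ! 1"
    using desc[of i] desc[of j] ij \<open>i \<noteq> j\<close> by (cases "i = 0") auto
  then show ?thesis
    by (simp add: second_eigenvalue_def Let_def L_def M_def A_def xs_def)
qed

text \<open>Symmetry makes the uniform law stationary. A single \<open>\<eta>\<close> bounds holding
  and a connecting set of transitions from below, so the chain is irreducible and aperiodic with
  quantitative control in terms of \<open>\<eta>\<close> and \<open>card \<Omega>\<close>.\<close>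

locale lazy_symmetric_chain =
  fixes \<Omega> :: "'s set" and P :: "'s \<Rightarrow> 's pmf" and \<eta> :: real
  assumes finite_states: "finite \<Omega>" and states_ne: "\<Omega> \<noteq> {}"
    and closed: "x \<in> \<Omega> \<Longrightarrow> set_pmf (P x) \<subseteq> \<Omega>"
    and symmetric: "x \<in> \<Omega> \<Longrightarrow> y \<in> \<Omega> \<Longrightarrow> pmf (P x) y = pmf (P y) x"
    and eta_pos: "0 < \<eta>"
    and holding: "x \<in> \<Omega> \<Longrightarrow> \<eta> \<le> pmf (P x) x"
    and irreducible: "x \<in> \<Omega> \<Longrightarrow> y \<in> \<Omega> \<Longrightarrow>
      (x, y) \<in> {(x, y). x \<in> \<Omega> \<and> y \<in> \<Omega> \<and> \<eta> \<le> pmf (P x) y}\<^sup>*"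
begin

section \<open>Quadratic and Dirichlet forms of a symmetric chain\<close>

lemma row_sum: "x \<in> \<Omega> \<Longrightarrow> (\<Sum>y\<in>\<Omega>. pmf (P x) y) = 1"
  using sum_pmf_eq_1[OF finite_states closed] .

lemma column_sum:
  assumes "y \<in> \<Omega>" shows "(\<Sum>x\<in>\<Omega>. pmf (P x) y) = 1"
proof -
  have "(\<Sum>x\<in>\<Omega>. pmf (P x) y) = (\<Sum>x\<in>\<Omega>. pmf (P y) x)"
    using assms by (intro sum.cong) (auto simp: symmetric)
  then show ?thesis using row_sum[OF assms] by simp
qed

definition form :: "('s \<Rightarrow> real) \<Rightarrow> ('s \<Rightarrow> real) \<Rightarrow> real" where
  "form f g = (\<Sum>x\<in>\<Omega>. \<Sum>y\<in>\<Omega>. pmf (P x) y * f x * g y)"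

text \<open>Taken with respect to counting measure, hence \<open>card \<Omega>\<close> times the
  Dirichlet form for the uniform law. \<open>form\<close> has the same normalisation.\<close>

definition dirichlet :: "('s \<Rightarrow> real) \<Rightarrow> real" where
  "dirichlet f = (\<Sum>x\<in>\<Omega>. \<Sum>y\<in>\<Omega>. pmf (P x) y * (f x - f y)\<^sup>2) / 2"

text \<open>Expand the square: the two pure terms reduce to the squared norm by the row sums and the
  column sums respectively.\<close>

lemma dirichlet_eq: "dirichlet f = (\<Sum>x\<in>\<Omega>. (f x)\<^sup>2) - form f f"
proof -
  have 1: "(\<Sum>x\<in>\<Omega>. \<Sum>y\<in>\<Omega>. pmf (P x) y * (f x)\<^sup>2) = (\<Sum>x\<in>\<Omega>. (f x)\<^sup>2)"
    using row_sum by (simp flip: sum_distrib_right)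
  have 2: "(\<Sum>x\<in>\<Omega>. \<Sum>y\<in>\<Omega>. pmf (P x) y * (f y)\<^sup>2) = (\<Sum>x\<in>\<Omega>. (f x)\<^sup>2)"
    by (subst sum.swap) (use column_sum in \<open>simp flip: sum_distrib_right\<close>)
  have "2 * dirichlet f = (\<Sum>x\<in>\<Omega>. \<Sum>y\<in>\<Omega>. pmf (P x) y * (f x)\<^sup>2)
      + (\<Sum>x\<in>\<Omega>. \<Sum>y\<in>\<Omega>. pmf (P x) y * (f y)\<^sup>2) - 2 * form f f"
    unfolding dirichlet_def form_def
    by (simp add: sum_distrib_left algebra_simps power2_eq_square flip: sum.distrib sum_subtractf)
  then show ?thesis using 1 2 by simp
qed

lemma form_commute: "form f g = form g f"
proof -
  have "form f g = (\<Sum>y\<in>\<Omega>. \<Sum>x\<in>\<Omega>. pmf (P x) y * f x * g y)"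
    unfolding form_def by (rule sum.swap)
  also have "\<dots> = form g f"
    unfolding form_def by (intro sum.cong refl) (simp add: symmetric mult_ac)
  finally show ?thesis .
qed

text \<open>If the form vanishes, then \<open>f\<close> agrees across every transition of positive
  probability, and irreducibility makes it constant.\<close>

lemma dirichlet_pos:
  assumes "x \<in> \<Omega>" "y \<in> \<Omega>" "f x \<noteq> f y"
  shows "0 < dirichlet f"
proof (rule ccontr)
  assume "\<not> 0 < dirichlet f"
  moreover have "0 \<le> dirichlet f"
    unfolding dirichlet_def by (simp add: sum_nonneg)
  ultimately have "(\<Sum>x\<in>\<Omega>. \<Sum>y\<in>\<Omega>. pmf (P x) y * (f x - f y)\<^sup>2) = 0"
    unfolding dirichlet_def by simp
  then have zero: "pmf (P x) y * (f x - f y)\<^sup>2 = 0" if "x \<in> \<Omega>" "y \<in> \<Omega>" for x y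
    using that finite_states by (simp add: sum_nonneg_eq_0_iff sum_nonneg)
  have "f x = f y"
    using irreducible[OF assms(1,2)]
  proof induction
    case (step y z)
    then show ?case using zero[of y z] eta_pos by auto
  qed simp
  then show False using assms by simp
qed

text \<open>The unit sphere of mean-zero functions is compact, so the quadratic form attains its
  maximum there; homogeneity extends the bound to all mean-zero functions. The function
  \<open>f\<close> only ensures that the sphere is nonempty.\<close>

lemma ex_extremal:
  fixes f :: "'s \<Rightarrow> real"
  assumes "x0 \<in> \<Omega>" "(\<Sum>x\<in>\<Omega>. f x) = 0" "f x0 \<noteq> 0"
  obtains g :: "'s \<Rightarrow> real" where "(\<Sum>x\<in>\<Omega>. g x) = 0" "(\<Sum>x\<in>\<Omega>. (g x)\<^sup>2) = 1"
    "\<And>h :: 's \<Rightarrow> real. (\<Sum>x\<in>\<Omega>. h x) = 0 \<Longrightarrow> form h h \<le> form g g * (\<Sum>x\<in>\<Omega>. (h x)\<^sup>2)"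
proof -
  \<comment> \<open>Functions are set to \<open>0\<close> off \<open>\<Omega>\<close>, so
    \<open>K\<close> is a product of compact sets even when the type of states is infinite.
    Coordinates of a unit vector lie in \<open>[-1, 1]\<close> automatically.\<close>
  define K where "K = Pi\<^sub>E UNIV (\<lambda>x. if x \<in> \<Omega> then {-1..1::real} else {0})"
  define S where "S = K \<inter> {g. (\<Sum>x\<in>\<Omega>. g x) = 0} \<inter> {g. (\<Sum>x\<in>\<Omega>. (g x)\<^sup>2) = 1}"
  have cont [continuous_intros]: "continuous_on T (\<lambda>g::'s \<Rightarrow> real. g x)" for T x
    by (rule continuous_on_subset[OF continuous_on_product_coordinates]) simp
  have "compact K"
    unfolding K_def compactin_euclidean_iff[symmetric] euclidean_product_topology[symmetric]
    by (subst compactin_PiE) auto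
  moreover have "closed {g::'s \<Rightarrow> real. (\<Sum>x\<in>\<Omega>. g x) = 0}" "closed {g::'s \<Rightarrow> real. (\<Sum>x\<in>\<Omega>. (g x)\<^sup>2) = 1}"
    by (intro closed_Collect_eq continuous_intros)+
  ultimately have "compact S"
    unfolding S_def by (intro compact_Int_closed)
  have normal: "(\<lambda>x. if x \<in> \<Omega> then h x / sqrt (\<Sum>x\<in>\<Omega>. (h x)\<^sup>2) else 0) \<in> S"
    if h: "(\<Sum>x\<in>\<Omega>. h x) = 0" and pos: "0 < (\<Sum>x\<in>\<Omega>. (h x)\<^sup>2)" for h :: "'s \<Rightarrow> real"
  proof -
    let ?s = "\<Sum>x\<in>\<Omega>. (h x)\<^sup>2"
    have "\<bar>h x\<bar> \<le> sqrt ?s" if "x \<in> \<Omega>" for x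
      using member_le_sum[of x \<Omega> "\<lambda>x. (h x)\<^sup>2"] that finite_states
      by (metis real_sqrt_abs real_sqrt_le_iff zero_le_power2)
    then have "\<bar>h x / sqrt ?s\<bar> \<le> 1" if "x \<in> \<Omega>" for x
      using that pos by (simp add: divide_le_eq)
    then have "-1 \<le> h x / sqrt ?s \<and> h x / sqrt ?s \<le> 1" if "x \<in> \<Omega>" for x
      using that by (metis abs_le_iff minus_le_iff)
    moreover have "(\<Sum>x\<in>\<Omega>. h x / sqrt ?s) = 0"
      using h by (simp flip: sum_divide_distrib)
    moreover have "(\<Sum>x\<in>\<Omega>. (h x / sqrt ?s)\<^sup>2) = 1"
      using pos by (simp add: power_divide flip: sum_divide_distrib)
    ultimately show ?thesis
      by (auto simp: S_def K_def PiE_iff)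
  qed
  have "0 < (\<Sum>x\<in>\<Omega>. (f x)\<^sup>2)"
    using assms finite_states by (intro sum_pos2[of _ x0]) auto
  with normal assms have "S \<noteq> {}" by blast
  moreover have "continuous_on S (\<lambda>g. form g g)"
    unfolding form_def by (intro continuous_intros)
  ultimately obtain g where g: "g \<in> S" and max: "\<And>h. h \<in> S \<Longrightarrow> form h h \<le> form g g"
    using continuous_attains_sup[OF \<open>compact S\<close>] by meson
  show thesis
  proof
    show "(\<Sum>x\<in>\<Omega>. g x) = 0" "(\<Sum>x\<in>\<Omega>. (g x)\<^sup>2) = 1"
      using g by (auto simp: S_def)
    fix h :: "'s \<Rightarrow> real" assume h: "(\<Sum>x\<in>\<Omega>. h x) = 0"
    let ?s = "\<Sum>x\<in>\<Omega>. (h x)\<^sup>2"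
    show "form h h \<le> form g g * ?s"
    proof (cases "0 < ?s")
      case True
      let ?h = "\<lambda>x. if x \<in> \<Omega> then h x / sqrt ?s else 0"
      have "form ?h ?h = (\<Sum>x\<in>\<Omega>. \<Sum>y\<in>\<Omega>. pmf (P x) y * h x * h y / ?s)"
        unfolding form_def using True by (intro sum.cong refl) simp
      also have "\<dots> = form h h / ?s"
        unfolding form_def by (simp add: sum_divide_distrib)
      finally have "form h h / ?s \<le> form g g"
        using max[OF normal[OF h True]] by (rule ord_eq_le_trans[OF sym])
      then show ?thesis
        using True by (simp only: pos_divide_le_eq)
    next
      case False
      moreover have "0 \<le> ?s" by (simp add: sum_nonneg)
      ultimately have "?s = 0" by linarith
      then have "h x = 0" if "x \<in> \<Omega>" for x
        using that finite_states by (simp add: sum_nonneg_eq_0_iff)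
      then have "form h h = 0" by (simp add: form_def)
      with \<open>?s = 0\<close> show ?thesis by simp
    qed
  qed
qed

text \<open>The extremal \<open>g\<close> is an eigenvector whose eigenvalue \<open>\<mu>\<close>
  lies below \<open>1\<close>, so \<open>\<mu>\<close> is at most the second eigenvalue; maximality
  of \<open>\<mu>\<close> then compares with \<open>f\<close>.\<close>

theorem spectral_gap_le_centered:
  assumes "(\<Sum>x\<in>\<Omega>. f x) = 0"
  shows "(1 - second_eigenvalue \<Omega> P) * (\<Sum>x\<in>\<Omega>. (f x)\<^sup>2) \<le> dirichlet f"
proof (cases "\<forall>x\<in>\<Omega>. f x = 0")
  case True
  then show ?thesis by (simp add: dirichlet_def)
next
  case False
  then obtain x0 where x0: "x0 \<in> \<Omega>" "f x0 \<noteq> 0" by blast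
  obtain g where g: "(\<Sum>x\<in>\<Omega>. g x) = 0" "(\<Sum>x\<in>\<Omega>. (g x)\<^sup>2) = 1"
    and max: "\<And>h. (\<Sum>x\<in>\<Omega>. h x) = 0 \<Longrightarrow> form h h \<le> form g g * (\<Sum>x\<in>\<Omega>. (h x)\<^sup>2)"
    using ex_extremal[OF x0(1) assms x0(2)] by blast
  define \<mu> where "\<mu> = form g g"
  \<comment> \<open>The residual of the eigenvalue equation, to be shown zero on
    \<open>\<Omega>\<close>. It has mean zero because columns sum to \<open>1\<close>, so it is an
    admissible direction of perturbation.\<close>
  define h where "h x = (\<Sum>y\<in>\<Omega>. pmf (P x) y * g y) - \<mu> * g x" for x
  have "(\<Sum>x\<in>\<Omega>. \<Sum>y\<in>\<Omega>. pmf (P x) y * g y) = (\<Sum>y\<in>\<Omega>. g y)"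
    by (subst sum.swap) (use column_sum in \<open>simp flip: sum_distrib_right\<close>)
  then have h0: "(\<Sum>x\<in>\<Omega>. h x) = 0"
    using g(1) by (simp add: h_def sum_subtractf flip: sum_distrib_left)
  define b where "b = (\<Sum>x\<in>\<Omega>. (h x)\<^sup>2)"
  define c where "c = \<mu> * b - form h h"
  \<comment> \<open>Pair \<open>h\<close> with itself and expand only one factor: \<open>b\<close>
    is half the first-order coefficient of the perturbation.\<close>
  have b_eq: "b = form h g - \<mu> * (\<Sum>x\<in>\<Omega>. h x * g x)"
    unfolding b_def form_def power2_eq_square
    by (subst (2) h_def) (simp add: algebra_simps sum_subtractf sum_distrib_left)
  \<comment> \<open>Perturbing the maximiser \<open>g\<close> in the direction \<open>h\<close> gives \<open>2 e b \<le> c e\<^sup>2\<close> for all \<open>e\<close>.\<close>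
  have ineq: "2 * e * b \<le> c * e\<^sup>2" for e
  proof -
    have "form (\<lambda>x. g x + e * h x) (\<lambda>x. g x + e * h x)
        = form g g + e * form g h + e * form h g + e\<^sup>2 * form h h"
      unfolding form_def
      by (simp add: algebra_simps power2_eq_square sum_distrib_left flip: sum.distrib)
    moreover have "(\<Sum>x\<in>\<Omega>. (g x + e * h x)\<^sup>2) = 1 + 2 * e * (\<Sum>x\<in>\<Omega>. h x * g x) + e\<^sup>2 * b"
      unfolding b_def g(2)[symmetric]
      by (simp add: algebra_simps power2_eq_square sum_distrib_left flip: sum.distrib)
    moreover have "(\<Sum>x\<in>\<Omega>. g x + e * h x) = 0"
      using g(1) h0 by (simp add: sum.distrib flip: sum_distrib_left)
    ultimately have "\<mu> + e * form h g + e * form h g + e\<^sup>2 * form h h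
        \<le> \<mu> * (1 + 2 * e * (\<Sum>x\<in>\<Omega>. h x * g x) + e\<^sup>2 * b)"
      using max[of "\<lambda>x. g x + e * h x"] form_commute[of g h] by (simp add: \<mu>_def)
    moreover have "e * b = e * form h g - e * (\<mu> * (\<Sum>x\<in>\<Omega>. h x * g x))"
      using b_eq by (simp add: right_diff_distrib)
    ultimately show ?thesis
      by (simp add: c_def algebra_simps)
  qed
  have "b = 0"
  proof (rule ccontr)
    assume "b \<noteq> 0"
    then have "0 < b" unfolding b_def by (metis less_eq_real_def sum_nonneg zero_le_power2)
    \<comment> \<open>Small enough for the linear term to win: this \<open>e\<close> gives
      \<open>c * e \<le> b\<close>, whence \<open>2 * b \<le> b\<close>.\<close>
    define e where "e = b / (\<bar>c\<bar> + 1)"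
    have "0 < e" using \<open>0 < b\<close> by (simp add: e_def)
    have "2 * b \<le> c * e"
      using ineq[of e] \<open>0 < e\<close> by (simp add: power2_eq_square)
    also have "\<dots> \<le> (\<bar>c\<bar> + 1) * e"
      using \<open>0 < e\<close> by (intro mult_right_mono) auto
    also have "\<dots> = b" by (simp add: e_def add_pos_nonneg)
    finally show False using \<open>0 < b\<close> by simp
  qed
  then have eig: "(\<Sum>y\<in>\<Omega>. pmf (P x) y * g y) = \<mu> * g x" if "x \<in> \<Omega>" for x
    using that finite_states by (simp add: b_def sum_nonneg_eq_0_iff h_def)
  obtain x1 where x1: "x1 \<in> \<Omega>" "g x1 \<noteq> 0"
    using g(2) by (metis (no_types, lifting) power_zero_numeral sum.neutral zero_neq_one)
  \<comment> \<open>A constant function with mean zero would vanish. Hence \<open>g\<close> has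
    positive Dirichlet form, and that form equals \<open>1 - \<mu>\<close>.\<close>
  have "\<exists>y\<in>\<Omega>. g x1 \<noteq> g y"
  proof (rule ccontr)
    assume "\<not> ?thesis"
    then have "(\<Sum>x\<in>\<Omega>. g x) = (\<Sum>x\<in>\<Omega>. g x1)" by (intro sum.cong) auto
    then show False using g(1) x1 finite_states by auto
  qed
  then have "0 < dirichlet g"
    using dirichlet_pos[OF x1(1)] by blast
  then have "\<mu> < 1" using dirichlet_eq[of g] g(2) by (simp add: \<mu>_def)
  then have "\<mu> \<le> second_eigenvalue \<Omega> P"
    using second_eigenvalue_ge[OF finite_states _ row_sum eig x1] by simp
  then have "(1 - second_eigenvalue \<Omega> P) * (\<Sum>x\<in>\<Omega>. (f x)\<^sup>2) \<le> (1 - \<mu>) * (\<Sum>x\<in>\<Omega>. (f x)\<^sup>2)"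
    by (intro mult_right_mono) (auto simp: sum_nonneg)
  also have "\<dots> \<le> dirichlet f"
    using max[OF assms] by (simp add: dirichlet_eq \<mu>_def algebra_simps)
  finally show ?thesis .
qed

text \<open>Centre \<open>f\<close> by its mean, which leaves the Dirichlet form unchanged. The
  second factor is \<open>card \<Omega>\<close> times the variance under the uniform law.\<close>

lemma spectral_gap_le:
  "(1 - second_eigenvalue \<Omega> P) * ((\<Sum>x\<in>\<Omega>. (f x)\<^sup>2) - (\<Sum>x\<in>\<Omega>. f x)\<^sup>2 / card \<Omega>) \<le> dirichlet f"
proof -
  define a where "a = (\<Sum>x\<in>\<Omega>. f x) / card \<Omega>"
  have c: "0 < card \<Omega>" using finite_states states_ne by (simp add: card_gt_0_iff)
  then have s: "(\<Sum>x\<in>\<Omega>. f x) = a * card \<Omega>" by (simp add: a_def)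
  have "(\<Sum>x\<in>\<Omega>. f x - a) = 0" using s by (simp add: sum_subtractf)
  from spectral_gap_le_centered[OF this]
  have "(1 - second_eigenvalue \<Omega> P) * (\<Sum>x\<in>\<Omega>. (f x - a)\<^sup>2) \<le> dirichlet f"
    by (simp add: dirichlet_def)
  moreover have "(\<Sum>x\<in>\<Omega>. (f x - a)\<^sup>2) = (\<Sum>x\<in>\<Omega>. (f x)\<^sup>2) - (\<Sum>x\<in>\<Omega>. f x)\<^sup>2 / card \<Omega>"
  proof -
    have "(\<Sum>x\<in>\<Omega>. (f x - a)\<^sup>2) = (\<Sum>x\<in>\<Omega>. (f x)\<^sup>2) - 2 * a * (\<Sum>x\<in>\<Omega>. f x) + a\<^sup>2 * card \<Omega>"
      by (simp add: power2_diff sum.distrib sum_subtractf sum_distrib_left sum_distrib_right mult_ac)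
    then show ?thesis unfolding s using c by (simp add: power2_eq_square algebra_simps)
  qed
  ultimately show ?thesis by simp
qed

end

section \<open>Doeblin bound on the mixing time\<close>

lemma chain_law_add:
  "chain_law P (s + t) x = bind_pmf (chain_law P s x) (chain_law P t)"
  by (induction t) (simp_all add: bind_return_pmf' bind_assoc_pmf)

text \<open>The infimum of a nonempty set of naturals belongs to it; \<open>t\<close> witnesses
  nonemptiness.\<close>

lemma mixing_time_works:
  assumes "0 < t" "worst_tv \<Omega> P \<pi> t < \<epsilon>"
  shows "0 < mixing_time \<Omega> P \<pi> \<epsilon>" "mixing_time \<Omega> P \<pi> \<epsilon> \<le> t"
    "worst_tv \<Omega> P \<pi> (mixing_time \<Omega> P \<pi> \<epsilon>) < \<epsilon>"
proof -
  let ?S = "{t. t > 0 \<and> worst_tv \<Omega> P \<pi> t < \<epsilon>}"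
  have t: "t \<in> ?S" using assms by simp
  then have "mixing_time \<Omega> P \<pi> \<epsilon> \<in> ?S"
    unfolding mixing_time_def by (intro Inf_nat_def1) auto
  then show "0 < mixing_time \<Omega> P \<pi> \<epsilon>" "worst_tv \<Omega> P \<pi> (mixing_time \<Omega> P \<pi> \<epsilon>) < \<epsilon>"
    by auto
  show "mixing_time \<Omega> P \<pi> \<epsilon> \<le> t"
    unfolding mixing_time_def using t by (intro cInf_lower) auto
qed

text \<open>The supremum dominates each term because the differences are bounded by
  \<open>1\<close>.\<close>

lemma prob_diff_le_tv_dist:
  "\<bar>measure_pmf.prob \<mu> A - measure_pmf.prob \<nu> A\<bar> \<le> tv_dist \<mu> \<nu>"
  unfolding tv_dist_def
proof (rule cSUP_upper)
  have "\<bar>measure_pmf.prob \<mu> A - measure_pmf.prob \<nu> A\<bar> \<le> 1" for A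
    using measure_pmf.prob_le_1[of \<mu> A] measure_pmf.prob_le_1[of \<nu> A]
      measure_nonneg[of "measure_pmf \<mu>" A] measure_nonneg[of "measure_pmf \<nu>" A] by linarith
  then show "bdd_above (range (\<lambda>A. \<bar>measure_pmf.prob \<mu> A - measure_pmf.prob \<nu> A\<bar>))"
    by (intro bdd_aboveI[of _ 1]) auto
qed simp

context lazy_symmetric_chain
begin

section \<open>Laws at later times, minorization and contraction\<close>

lemma law_closed: "x \<in> \<Omega> \<Longrightarrow> set_pmf (chain_law P t x) \<subseteq> \<Omega>"
  by (induction t) (use closed in auto)

lemma law_finite: "x \<in> \<Omega> \<Longrightarrow> finite (set_pmf (chain_law P t x))"
  using law_closed finite_states by (metis finite_subset)

lemma expectation_law_Suc:
  fixes h :: "'s \<Rightarrow> real"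
  assumes "x \<in> \<Omega>"
  shows "measure_pmf.expectation (chain_law P (Suc t) x) h =
    (\<Sum>z\<in>\<Omega>. pmf (chain_law P t x) z * measure_pmf.expectation (P z) h)"
  using pmf_expectation_bind[of \<Omega> P "chain_law P t x" h] assms law_closed finite_states
    finite_subset[OF closed finite_states]
  by simp

lemma prob_law_add:
  assumes "x \<in> \<Omega>"
  shows "measure_pmf.prob (chain_law P (s + t) x) A =
    (\<Sum>z\<in>\<Omega>. pmf (chain_law P s x) z * measure_pmf.prob (chain_law P t z) A)"
  using pmf_expectation_bind[of \<Omega> "chain_law P t" "chain_law P s x" "indicat_real A"]
    assms law_closed finite_states law_finite
  by (simp add: chain_law_add)

lemma stationary: "bind_pmf (pmf_of_set \<Omega>) (chain_law P t) = pmf_of_set \<Omega>"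
proof -
  have step: "bind_pmf (pmf_of_set \<Omega>) P = pmf_of_set \<Omega>"
  proof (rule pmf_eqI)
    fix y
    show "pmf (bind_pmf (pmf_of_set \<Omega>) P) y = pmf (pmf_of_set \<Omega>) y"
    proof (cases "y \<in> \<Omega>")
      case True
      then show ?thesis
        using states_ne finite_states column_sum by (simp add: pmf_bind_pmf_of_set)
    next
      case False
      then have "pmf (P x) y = 0" if "x \<in> \<Omega>" for x
        using closed[OF that] by (auto simp: pmf_eq_0_set_pmf)
      then show ?thesis
        using False states_ne finite_states by (simp add: pmf_bind_pmf_of_set)
    qed
  qed
  show ?thesis
    by (induction t) (simp_all add: bind_return_pmf' step flip: bind_assoc_pmf)
qed

text \<open>Some path of at most \<open>(card \<Omega>)\<^sup>2\<close> transitions, each of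
  probability at least \<open>\<eta>\<close>, leads from \<open>x\<close> to \<open>y\<close>.
  Waiting at \<open>y\<close> pads it to exactly that length, so that one time serves all
  pairs.\<close>

lemma minorization:
  assumes "x \<in> \<Omega>" "y \<in> \<Omega>"
  shows "\<eta> ^ (card \<Omega>)\<^sup>2 \<le> pmf (chain_law P ((card \<Omega>)\<^sup>2) x) y"
proof -
  define R where "R = {(x, y). x \<in> \<Omega> \<and> y \<in> \<Omega> \<and> \<eta> \<le> pmf (P x) y}"
  have step: "\<eta> ^ Suc n \<le> pmf (chain_law P (Suc n) x) z"
    if "\<eta> ^ n \<le> pmf (chain_law P n x) y" "y \<in> \<Omega>" "\<eta> \<le> pmf (P y) z" for n y z
  proof -
    have "\<eta> ^ Suc n \<le> pmf (chain_law P n x) y * pmf (P y) z"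
      using that eta_pos unfolding power_Suc2 by (intro mult_mono) auto
    also have "\<dots> \<le> (\<Sum>y\<in>\<Omega>. pmf (chain_law P n x) y * pmf (P y) z)"
      using that finite_states by (intro member_le_sum) auto
    also have "\<dots> = pmf (chain_law P (Suc n) x) z"
      using law_closed[OF assms(1), of n] finite_states
      by (simp add: pmf_bind) (subst integral_measure_pmf_real[of \<Omega>], auto simp: mult.commute)
    finally show ?thesis .
  qed
  have "finite R"
    unfolding R_def by (rule finite_subset[of _ "\<Omega> \<times> \<Omega>"]) (use finite_states in auto)
  moreover have "(x, y) \<in> R\<^sup>*"
    using irreducible[OF assms] by (simp add: R_def)
  \<comment> \<open>In a finite relation, reachability needs no more steps than the relation has
    pairs.\<close>
  ultimately obtain n where n: "n \<le> card R" "(x, y) \<in> R ^^ n"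
    by (auto simp: rtrancl_finite_eq_relpow)
  have "\<eta> ^ n \<le> pmf (chain_law P n x) y"
    using n(2)
  proof (induction n arbitrary: y)
    case (Suc n)
    then obtain w where "(x, w) \<in> R ^^ n" "(w, y) \<in> R" by auto
    then show ?case using Suc.IH step[of n w y] by (auto simp: R_def)
  qed simp
  then have le: "\<eta> ^ (n + k) \<le> pmf (chain_law P (n + k) x) y" for k
  proof (induction k)
    case (Suc k)
    then show ?case using step[of "n + k" y y] assms holding by simp
  qed simp
  have "card R \<le> card (\<Omega> \<times> \<Omega>)"
    using finite_states by (intro card_mono) (auto simp: R_def)
  then have "n \<le> (card \<Omega>)\<^sup>2"
    using n(1) by (simp add: card_cartesian_product power2_eq_square)
  then show ?thesis
    using le[of "(card \<Omega>)\<^sup>2 - n"] by simp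
qed

text \<open>After a first block of \<open>(card \<Omega>)\<^sup>2\<close> steps every state carries
  mass at least \<open>\<delta>\<close>. This shrinks the oscillation over starting points of the
  remaining probability by the factor \<open>1 - \<delta>\<close>.\<close>

lemma doeblin_contraction:
  assumes "x \<in> \<Omega>" "y \<in> \<Omega>"
  shows "measure_pmf.prob (chain_law P (k * (card \<Omega>)\<^sup>2) x) A
    - measure_pmf.prob (chain_law P (k * (card \<Omega>)\<^sup>2) y) A \<le> (1 - \<eta> ^ (card \<Omega>)\<^sup>2) ^ k"
  using assms
proof (induction k arbitrary: x y)
  case 0
  show ?case by (simp add: indicator_def)
next
  case (Suc k)
  define T where "T = (card \<Omega>)\<^sup>2"
  define \<delta> where "\<delta> = \<eta> ^ T"
  define f where "f z = measure_pmf.prob (chain_law P (k * T) z) A" for z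
  define q where "q x = pmf (chain_law P T x)" for x
  have step: "measure_pmf.prob (chain_law P (Suc k * T) x) A = (\<Sum>z\<in>\<Omega>. q x z * f z)"
    if "x \<in> \<Omega>" for x
    using prob_law_add[OF that, of T "k * T" A] by (simp add: f_def q_def)
  have q1: "(\<Sum>z\<in>\<Omega>. q x z) = 1" if "x \<in> \<Omega>" for x
    using law_closed[OF that] finite_states unfolding q_def by (intro sum_pmf_eq_1)
  obtain lo where lo: "lo \<in> \<Omega>" "\<And>z. z \<in> \<Omega> \<Longrightarrow> f lo \<le> f z"
    using ex_is_arg_min_if_finite[OF finite_states states_ne, of f]
    by (auto simp: is_arg_min_linorder)
  obtain hi where hi: "hi \<in> \<Omega>" "\<And>z. z \<in> \<Omega> \<Longrightarrow> f z \<le> f hi"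
    using ex_is_arg_min_if_finite[OF finite_states states_ne, of "\<lambda>z. - f z"]
    by (auto simp: is_arg_min_linorder)
  \<comment> \<open>The mass at the minimiser pulls the average from \<open>x\<close> below the
    maximum by at least \<open>\<delta> * (f hi - f lo)\<close>, while the average from
    \<open>y\<close> is at least \<open>f lo\<close>.\<close>
  have "(\<Sum>z\<in>\<Omega>. q x z * (f hi - f z)) \<ge> q x lo * (f hi - f lo)"
    using lo hi finite_states by (intro member_le_sum) (auto simp: q_def)
  moreover have "q x lo * (f hi - f lo) \<ge> \<delta> * (f hi - f lo)"
    using minorization[of x lo] lo hi Suc.prems
    by (intro mult_right_mono) (auto simp: q_def \<delta>_def T_def)
  moreover have "(\<Sum>z\<in>\<Omega>. q x z * (f hi - f z)) = f hi - (\<Sum>z\<in>\<Omega>. q x z * f z)"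
    using q1[of x] Suc.prems by (simp add: right_diff_distrib sum_subtractf flip: sum_distrib_right)
  moreover have "f lo \<le> (\<Sum>z\<in>\<Omega>. q y z * f z)"
  proof -
    have "f lo = (\<Sum>z\<in>\<Omega>. q y z * f lo)"
      using q1[of y] Suc.prems by (simp flip: sum_distrib_right)
    also have "\<dots> \<le> (\<Sum>z\<in>\<Omega>. q y z * f z)"
      using lo by (intro sum_mono mult_left_mono) (auto simp: q_def)
    finally show ?thesis .
  qed
  ultimately have "(\<Sum>z\<in>\<Omega>. q x z * f z) - (\<Sum>z\<in>\<Omega>. q y z * f z) \<le> (1 - \<delta>) * (f hi - f lo)"
    by (simp add: algebra_simps)
  also have "\<dots> \<le> (1 - \<delta>) * (1 - \<delta>) ^ k"
  proof (rule mult_left_mono)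
    show "f hi - f lo \<le> (1 - \<delta>) ^ k"
      using Suc.IH[OF hi(1) lo(1)] by (simp add: f_def \<delta>_def T_def)
    have "\<delta> \<le> pmf (chain_law P T lo) lo"
      using minorization[OF lo(1) lo(1)] by (simp add: \<delta>_def T_def)
    then show "0 \<le> 1 - \<delta>" using pmf_le_1[of "chain_law P T lo" lo] by linarith
  qed
  finally show ?case
    using step Suc.prems by (simp add: \<delta>_def T_def)
qed

text \<open>By stationarity the uniform probability of \<open>A\<close> is the average over all
  starting states, so the contraction between pairs of starts passes to the distance from
  equilibrium.\<close>

lemma worst_tv_le:
  "worst_tv \<Omega> P (pmf_of_set \<Omega>) (k * (card \<Omega>)\<^sup>2) \<le> (1 - \<eta> ^ (card \<Omega>)\<^sup>2) ^ k"
proof -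
  let ?b = "(1 - \<eta> ^ (card \<Omega>)\<^sup>2) ^ k"
  let ?f = "\<lambda>A z. measure_pmf.prob (chain_law P (k * (card \<Omega>)\<^sup>2) z) A"
  have c: "0 < card \<Omega>" using finite_states states_ne by (simp add: card_gt_0_iff)
  have avg: "measure_pmf.prob (pmf_of_set \<Omega>) A = (\<Sum>z\<in>\<Omega>. ?f A z) / card \<Omega>" for A
    using pmf_expectation_bind_pmf_of_set[OF states_ne finite_states law_finite, of "\<lambda>x. x" "\<lambda>_. k * (card \<Omega>)\<^sup>2" "indicat_real A"]
    by (simp add: stationary sum_divide_distrib field_simps)
  have "\<bar>?f A x - measure_pmf.prob (pmf_of_set \<Omega>) A\<bar> \<le> ?b" if x: "x \<in> \<Omega>" for x A
  proof -
    have "(\<Sum>z\<in>\<Omega>. ?f A z) \<le> (\<Sum>z\<in>\<Omega>. ?f A x + ?b)"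
    proof (rule sum_mono)
      show "?f A z \<le> ?f A x + ?b" if "z \<in> \<Omega>" for z
        using doeblin_contraction[OF that x, of k A] by linarith
    qed
    moreover have "(\<Sum>z\<in>\<Omega>. ?f A x - ?b) \<le> (\<Sum>z\<in>\<Omega>. ?f A z)"
    proof (rule sum_mono)
      show "?f A x - ?b \<le> ?f A z" if "z \<in> \<Omega>" for z
        using doeblin_contraction[OF x that, of k A] by linarith
    qed
    ultimately show ?thesis
      unfolding avg using c by (simp add: abs_le_iff field_simps)
  qed
  then show ?thesis
    unfolding worst_tv_def tv_dist_def using finite_states states_ne
    by (auto intro!: cSUP_least)
qed

lemma ex_mixed:
  assumes "0 < \<epsilon>"
  shows "\<exists>k>0. (1 - \<eta> ^ (card \<Omega>)\<^sup>2) ^ k < \<epsilon>"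
proof -
  obtain x where "x \<in> \<Omega>" using states_ne by blast
  then have "\<eta> ^ (card \<Omega>)\<^sup>2 \<le> 1"
    using minorization pmf_le_1 by (meson order_trans)
  moreover have "0 < \<eta> ^ (card \<Omega>)\<^sup>2" using eta_pos by simp
  ultimately obtain k where k: "(1 - \<eta> ^ (card \<Omega>)\<^sup>2) ^ k < \<epsilon>"
    using real_arch_pow_inv[OF assms, of "1 - \<eta> ^ (card \<Omega>)\<^sup>2"] by auto
  \<comment> \<open>One more block makes the exponent positive, as \<open>mixing_time\<close> ranges
    over positive times.\<close>
  have "(1 - \<eta> ^ (card \<Omega>)\<^sup>2) ^ Suc k \<le> (1 - \<eta> ^ (card \<Omega>)\<^sup>2) ^ k"
    using \<open>\<eta> ^ (card \<Omega>)\<^sup>2 \<le> 1\<close> \<open>0 < \<eta> ^ (card \<Omega>)\<^sup>2\<close> by (intro power_decreasing) auto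
  with k show ?thesis by (intro exI[of _ "Suc k"]) auto
qed

end

text \<open>A function of the parameters alone, so that it bounds the mixing time of all chains with
  the same \<open>\<eta>\<close> and number of states at once.\<close>

definition doeblin_time :: "real \<Rightarrow> nat \<Rightarrow> real \<Rightarrow> nat" where
  "doeblin_time \<eta> m \<epsilon> = m\<^sup>2 * (LEAST k. k > 0 \<and> (1 - \<eta> ^ m\<^sup>2) ^ k < \<epsilon>)"

theorem (in lazy_symmetric_chain) mixing_time_doeblin:
  assumes "0 < \<epsilon>"
  shows "0 < mixing_time \<Omega> P (pmf_of_set \<Omega>) \<epsilon>"
    and "mixing_time \<Omega> P (pmf_of_set \<Omega>) \<epsilon> \<le> doeblin_time \<eta> (card \<Omega>) \<epsilon>"
    and "worst_tv \<Omega> P (pmf_of_set \<Omega>) (mixing_time \<Omega> P (pmf_of_set \<Omega>) \<epsilon>) < \<epsilon>"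
proof -
  define k where "k = (LEAST k. k > 0 \<and> (1 - \<eta> ^ (card \<Omega>)\<^sup>2) ^ k < \<epsilon>)"
  have k: "k > 0 \<and> (1 - \<eta> ^ (card \<Omega>)\<^sup>2) ^ k < \<epsilon>"
    unfolding k_def using ex_mixed[OF assms] by (rule LeastI_ex)
  have "0 < k * (card \<Omega>)\<^sup>2"
    using k finite_states states_ne by (simp add: card_gt_0_iff)
  moreover have "worst_tv \<Omega> P (pmf_of_set \<Omega>) (k * (card \<Omega>)\<^sup>2) < \<epsilon>"
    using worst_tv_le[of k] k by simp
  ultimately show "0 < mixing_time \<Omega> P (pmf_of_set \<Omega>) \<epsilon>"
    and "mixing_time \<Omega> P (pmf_of_set \<Omega>) \<epsilon> \<le> doeblin_time \<eta> (card \<Omega>) \<epsilon>"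
    and "worst_tv \<Omega> P (pmf_of_set \<Omega>) (mixing_time \<Omega> P (pmf_of_set \<Omega>) \<epsilon>) < \<epsilon>"
    using mixing_time_works[of "k * (card \<Omega>)\<^sup>2" \<Omega> P "pmf_of_set \<Omega>" \<epsilon>]
    by (simp_all add: doeblin_time_def k_def mult.commute)
qed

section \<open>The interchange process of a connected graph\<close>

locale interchange_graph =
  fixes V :: "'a set" and E :: "'a set set"
  assumes simple: "simple_graph V E" and connected: "connected_graph V E"
    and two_vertices: "2 \<le> card V"
begin

section \<open>Edges of the graph and a single step of the process\<close>

lemma finite_V: "finite V"
  using simple by (simp add: simple_graph_def)

lemma E_subset: "E \<subseteq> Pow V"
  using simple by (auto simp: simple_graph_def)

lemma finite_E: "finite E"
  using E_subset finite_V by (meson finite_Pow_iff finite_subset)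

lemma edgeE:
  assumes "e \<in> E"
  obtains u v where "e = {u, v}" "u \<in> V" "v \<in> V" "u \<noteq> v"
proof -
  have "card e = 2" "e \<subseteq> V"
    using assms simple by (auto simp: simple_graph_def)
  then show thesis
    using that by (auto simp: card_2_iff)
qed

lemma E_nonempty: "E \<noteq> {}"
proof
  assume "E = {}"
  obtain u v where uv: "u \<in> V" "v \<in> V" "u \<noteq> v"
    using two_vertices finite_V by (metis card_2_iff' card_le_Suc0_iff_eq not_less_eq_eq numeral_2_eq_2)
  then have "(u, v) \<in> {(x, y). {x, y} \<in> E}\<^sup>*"
    using connected by (auto simp: connected_graph_def)
  with \<open>E = {}\<close> uv show False
    by (auto elim: rtranclE)
qed

lemma card_E_pos: "0 < card E"
  using finite_E E_nonempty by (simp add: card_gt_0_iff)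

text \<open>This crude bound turns the probability \<open>1 / (2 * card E)\<close> of a given swap
  into a lower bound depending on \<open>card V\<close> only.\<close>

lemma card_E_le: "card E \<le> 2 ^ card V"
  using card_mono[OF _ E_subset] finite_V by (simp add: card_Pow)

lemma finite_perms: "finite (perms V)"
  unfolding perms_def using finite_permutations[OF finite_V] .

lemma card_perms: "card (perms V) = fact (card V)"
  unfolding perms_def using card_permutations[OF refl finite_V] .

lemma edge_swap_permutes: "e \<in> E \<Longrightarrow> edge_swap e permutes V"
  by (elim edgeE) (simp add: edge_swap_doubleton permutes_swap_id)

lemma edge_swap_involutory: "e \<in> E \<Longrightarrow> edge_swap e \<circ> edge_swap e = id"
  by (elim edgeE) (simp add: edge_swap_doubleton)

lemma comp_edge_swap_in_perms: "p \<in> perms V \<Longrightarrow> e \<in> E \<Longrightarrow> p \<circ> edge_swap e \<in> perms V"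
  using edge_swap_permutes by (auto simp: perms_def intro: permutes_compose)

lemma expectation_step:
  fixes h :: "('a \<Rightarrow> 'a) \<Rightarrow> real"
  shows "measure_pmf.expectation (interchange_step E p) h =
    h p / 2 + (\<Sum>e\<in>E. h (p \<circ> edge_swap e)) / (2 * card E)"
  unfolding interchange_step_def
  using finite_E E_nonempty
  by (subst pmf_expectation_bind[of UNIV])
    (auto simp: UNIV_bool integral_pmf_of_set)

lemma pmf_step:
  "pmf (interchange_step E p) q =
    indicat_real {q} p / 2 + (\<Sum>e\<in>E. indicat_real {q} (p \<circ> edge_swap e)) / (2 * card E)"
  using expectation_step[of p "indicat_real {q}"] by (simp add: measure_pmf_single)

lemma pmf_step_self: "1 / 2 ^ Suc (card V) \<le> pmf (interchange_step E p) p"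
proof -
  have "1 / 2 ^ Suc (card V) \<le> (1 / 2 :: real)"
    by (simp add: field_simps)
  also have "\<dots> \<le> pmf (interchange_step E p) p"
    unfolding pmf_step by (simp add: sum_nonneg)
  finally show ?thesis .
qed

lemma pmf_step_edge:
  assumes "e \<in> E"
  shows "1 / 2 ^ Suc (card V) \<le> pmf (interchange_step E p) (p \<circ> edge_swap e)"
proof -
  let ?q = "p \<circ> edge_swap e"
  have "real (card E) \<le> 2 ^ card V"
    using card_E_le by (metis of_nat_le_iff of_nat_numeral of_nat_power)
  then have "1 / 2 ^ Suc (card V) \<le> 1 / (2 * real (card E))"
    using card_E_pos by (intro divide_left_mono) auto
  also have "\<dots> \<le> (\<Sum>e\<in>E. indicat_real {?q} (p \<circ> edge_swap e)) / (2 * card E)"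
    using member_le_sum[of e E "\<lambda>e. indicat_real {?q} (p \<circ> edge_swap e)"] assms finite_E
    by (simp add: divide_right_mono)
  also have "\<dots> \<le> pmf (interchange_step E p) ?q"
    unfolding pmf_step by simp
  finally show ?thesis .
qed

section \<open>Irreducibility: edge transpositions generate all permutations\<close>

definition reach :: "(('a \<Rightarrow> 'a) \<times> ('a \<Rightarrow> 'a)) set" where
  "reach = {(p, q). p \<in> perms V \<and> q \<in> perms V \<and> 1 / 2 ^ Suc (card V) \<le> pmf (interchange_step E p) q}\<^sup>*"

text \<open>Right multipliers that the process can realise from every state. Quantifying over the
  start \<open>p\<close> makes the set closed under composition.\<close>

definition generated :: "('a \<Rightarrow> 'a) set" where
  "generated = {q. q permutes V \<and> (\<forall>p\<in>perms V. (p, p \<circ> q) \<in> reach)}"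

lemma generated_comp:
  assumes "q \<in> generated" "r \<in> generated"
  shows "q \<circ> r \<in> generated"
proof -
  have "(p, p \<circ> (q \<circ> r)) \<in> reach" if "p \<in> perms V" for p
  proof -
    have "(p, p \<circ> q) \<in> reach" "p \<circ> q \<in> perms V"
      using assms(1) that by (auto simp: generated_def perms_def intro: permutes_compose)
    moreover then have "(p \<circ> q, p \<circ> q \<circ> r) \<in> reach"
      using assms(2) by (auto simp: generated_def)
    ultimately show ?thesis
      unfolding reach_def by (simp add: comp_assoc)
  qed
  then show ?thesis
    using assms by (auto simp: generated_def intro: permutes_compose)
qed

lemma edge_swap_generated: "e \<in> E \<Longrightarrow> edge_swap e \<in> generated"
  using pmf_step_edge[of e] comp_edge_swap_in_perms[of _ e] edge_swap_permutes[of e]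
  by (auto simp: generated_def reach_def intro!: r_into_rtrancl)

lemma id_generated: "id \<in> generated"
  by (auto simp: generated_def reach_def)

text \<open>Induction along a path from \<open>u\<close> to \<open>v\<close>, extending the
  transposition by one edge at a time.\<close>

lemma transpose_generated:
  assumes "u \<in> V" "v \<in> V"
  shows "Transposition.transpose u v \<in> generated"
proof -
  have "(u, v) \<in> {(x, y). {x, y} \<in> E}\<^sup>*"
    using connected assms by (auto simp: connected_graph_def)
  then show ?thesis
  proof induction
    case base
    then show ?case using id_generated by (simp add: id_def)
  next
    case (step v w)
    then have vw: "Transposition.transpose v w \<in> generated"
      using edge_swap_generated by (fastforce simp: edge_swap_doubleton)
    show ?case
    proof (cases "u = w \<or> v = w \<or> u = v")
      case True
      then show ?thesis using step.IH vw id_generated by (auto simp: id_def)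
    next
      case False
      \<comment> \<open>Conjugating \<open>(u v)\<close> by the edge transposition
        \<open>(v w)\<close> gives \<open>(u w)\<close>.\<close>
      then have "Transposition.transpose u w =
          Transposition.transpose v w \<circ> (Transposition.transpose u v \<circ> Transposition.transpose v w)"
        by (auto simp: fun_eq_iff Transposition.transpose_def)
      then show ?thesis
        using generated_comp[OF vw generated_comp[OF step.IH vw]] by (simp only:)
    qed
  qed
qed

lemma permutation_generated:
  assumes "p permutes V" shows "p \<in> generated"
  using assms finite_V
proof (induction rule: permutes_induct)
  case id
  show ?case by (rule id_generated)
next
  case (swap a b p)
  then show ?case using generated_comp[OF transpose_generated] by blast
qed

lemma perms_reachable:
  assumes "p \<in> perms V" "q \<in> perms V"
  shows "(p, q) \<in> reach"
proof -
  have "inv_into UNIV p \<circ> q \<in> generated"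
    using assms by (intro permutation_generated) (auto simp: perms_def permutes_inv intro: permutes_compose)
  then have "(p, p \<circ> (inv_into UNIV p \<circ> q)) \<in> reach"
    using assms by (auto simp: generated_def)
  moreover have "p \<circ> (inv_into UNIV p \<circ> q) = q"
    using assms(1) by (simp add: perms_def permutes_inv_o flip: comp_assoc)
  ultimately show ?thesis by simp
qed

sublocale lazy_symmetric_chain "perms V" "interchange_step E" "1 / 2 ^ Suc (card V)"
proof
  show "finite (perms V)" by (rule finite_perms)
  show "perms V \<noteq> {}" by (auto simp: perms_def intro: permutes_id)
  show "set_pmf (interchange_step E p) \<subseteq> perms V" if "p \<in> perms V" for p
    using that comp_edge_swap_in_perms set_pmf_of_set[OF E_nonempty finite_E]
    by (auto simp: interchange_step_def split: if_splits)
  show "pmf (interchange_step E p) q = pmf (interchange_step E q) p" for p q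
  proof -
    \<comment> \<open>Swaps are involutions, which makes the kernel symmetric.\<close>
    have "p \<circ> edge_swap e = q \<longleftrightarrow> q \<circ> edge_swap e = p" if "e \<in> E" for e
      using edge_swap_involutory[OF that] by (metis comp_assoc comp_id)
    then show ?thesis
      unfolding pmf_step by (intro arg_cong2[where f="(+)"] arg_cong2[where f="(/)"] sum.cong)
        (auto simp: indicator_def)
  qed
  show "(0::real) < 1 / 2 ^ Suc (card V)" by simp
  show "1 / 2 ^ Suc (card V) \<le> pmf (interchange_step E p) p" for p
    by (rule pmf_step_self)
  show "(p, q) \<in> {(x, y). x \<in> perms V \<and> y \<in> perms V \<and>
      1 / 2 ^ Suc (card V) \<le> pmf (interchange_step E x) y}\<^sup>*"
    if "p \<in> perms V" "q \<in> perms V" for p q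
    using perms_reachable[OF that] by (simp only: reach_def)
qed

text \<open>Relabelling by \<open>(a b)\<close> on the left is a bijection between the permutations
  with \<open>p u = b\<close> and those with \<open>p u = a\<close>, so the \<open>card V\<close>
  classes have equal size.\<close>

lemma card_perms_at:
  assumes "u \<in> V" "a \<in> V"
  shows "real (card {p \<in> perms V. p u = a}) = card (perms V) / card V"
proof -
  let ?F = "\<lambda>a. {p \<in> perms V. p u = a}"
  have same: "card (?F b) = card (?F a)" if "b \<in> V" for b
  proof (rule bij_betw_same_card)
    let ?t = "\<lambda>p. Transposition.transpose a b \<circ> p"
    have "?t p \<in> perms V" if "p \<in> perms V" for p
      using that \<open>b \<in> V\<close> assms by (auto simp: perms_def intro: permutes_compose permutes_swap_id)
    then show "bij_betw ?t (?F b) (?F a)"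
      by (intro bij_betw_byWitness[where f'="?t"]) (auto simp: fun_eq_iff)
  qed
  have "perms V = (\<Union>b\<in>V. ?F b)"
    using assms by (auto simp: perms_def permutes_in_image)
  then have "card (perms V) = card (\<Union>b\<in>V. ?F b)" by simp
  also have "\<dots> = (\<Sum>b\<in>V. card (?F b))"
    using finite_V finite_perms by (intro card_UN_disjoint) auto
  also have "\<dots> = (\<Sum>b\<in>V. card (?F a))"
    by (intro sum.cong refl same)
  finally show ?thesis
    using two_vertices by (simp add: field_simps)
qed

text \<open>Holding contributes nothing. The factor \<open>1 / 4\<close> combines the
  \<open>1 / 2\<close> of the Dirichlet form with the \<open>1 / 2\<close> of a non-lazy
  step.\<close>

lemma dirichlet_interchange:
  "dirichlet f = (\<Sum>e\<in>E. \<Sum>p\<in>perms V. (f p - f (p \<circ> edge_swap e))\<^sup>2) / (4 * card E)"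
proof -
  have "(\<Sum>q\<in>perms V. pmf (interchange_step E p) q * (f p - f q)\<^sup>2)
      = (\<Sum>e\<in>E. (f p - f (p \<circ> edge_swap e))\<^sup>2) / (2 * card E)" if "p \<in> perms V" for p
    using expectation_step[of p "\<lambda>q. (f p - f q)\<^sup>2"] closed[OF that] finite_perms
    by (subst (asm) integral_measure_pmf_real[of "perms V"]) (auto simp: mult.commute)
  then have "dirichlet f = (\<Sum>p\<in>perms V. (\<Sum>e\<in>E. (f p - f (p \<circ> edge_swap e))\<^sup>2) / (2 * card E)) / 2"
    unfolding dirichlet_def by simp
  also have "\<dots> = (\<Sum>p\<in>perms V. \<Sum>e\<in>E. (f p - f (p \<circ> edge_swap e))\<^sup>2) / (4 * card E)"
    by (simp flip: sum_divide_distrib)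
  also have "\<dots> = (\<Sum>e\<in>E. \<Sum>p\<in>perms V. (f p - f (p \<circ> edge_swap e))\<^sup>2) / (4 * card E)"
    by (subst sum.swap) simp
  finally show ?thesis .
qed

section \<open>Edge boundary and the spectral gap\<close>

lemma boundary_subset: "edge_boundary V E W \<subseteq> E"
  by (auto simp: edge_boundary_def)

lemma edge_swap_image:
  assumes "e \<in> E" "e \<notin> edge_boundary V E W" "W \<subseteq> V"
  shows "edge_swap e ` W = W"
proof -
  obtain u v where uv: "e = {u, v}" "u \<in> V" "v \<in> V"
    using edgeE[OF assms(1)] by metis
  have "u \<in> W \<longleftrightarrow> v \<in> W"
    using assms uv by (auto simp: edge_boundary_def insert_commute)
  then have "Transposition.transpose u v ` W = W"
    by (cases "u \<in> W") (auto simp: image_iff Transposition.transpose_def split: if_splits)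
  then show ?thesis
    using uv by (simp add: edge_swap_doubleton)
qed

text \<open>The test function \<open>f\<close> indicates that particle \<open>a\<close> sits in
  \<open>W\<close>, an event of probability \<open>card W / card V\<close>. A swap changes it only
  along a boundary edge with \<open>a\<close> at one endpoint.\<close>

theorem spectral_gap_le_boundary:
  assumes W: "W \<subseteq> V"
  shows "(1 - lambda2_IP V E) * (card W * (1 - card W / card V))
    \<le> card (edge_boundary V E W) / (2 * card E)"
proof -
  obtain a where a: "a \<in> V" using two_vertices by fastforce
  define M where "M = real (card (perms V))"
  define N where "N = real (card V)"
  define w where "w = real (card W)"
  have pos: "0 < M" "0 < N"
    using two_vertices by (auto simp: M_def N_def card_perms)
  define f where "f p = (of_bool (a \<in> p ` W) :: real)" for p :: "'a \<Rightarrow> 'a"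
  have at: "(\<Sum>p\<in>perms V. of_bool (p u = a)) = M / N" if "u \<in> V" for u
    using card_perms_at[OF that a] finite_perms
    by (simp add: M_def N_def Int_def flip: of_bool_def)
  have f_sum: "f p = (\<Sum>u\<in>W. of_bool (p u = a))" if "p \<in> perms V" for p
  proof -
    have inj: "inj p" using that by (auto simp: perms_def permutes_inj)
    show ?thesis
    proof (cases "a \<in> p ` W")
      case True
      then obtain u where u: "u \<in> W" "a = p u" by blast
      then have "(\<Sum>u\<in>W. of_bool (p u = a) :: real) = (\<Sum>v\<in>W. if v = u then 1 else 0)"
        using inj by (intro sum.cong) (auto dest: injD)
      then show ?thesis
        using True u finite_subset[OF W finite_V] by (simp add: f_def)
    next
      case False
      then have "p u \<noteq> a" if "u \<in> W" for u
        using that by blast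
      with False show ?thesis by (simp add: f_def)
    qed
  qed
  have "(\<Sum>p\<in>perms V. f p) = (\<Sum>u\<in>W. \<Sum>p\<in>perms V. of_bool (p u = a))"
    by (subst sum.swap) (simp add: f_sum)
  also have "\<dots> = (\<Sum>u\<in>W. M / N)"
    using at W by (intro sum.cong) auto
  finally have mean: "(\<Sum>p\<in>perms V. f p) = w * M / N" by (simp add: w_def)
  have "(\<Sum>p\<in>perms V. (f p)\<^sup>2) = (\<Sum>p\<in>perms V. f p)"
    by (intro sum.cong) (auto simp: f_def)
  with mean have square: "(\<Sum>p\<in>perms V. (f p)\<^sup>2) = w * M / N" by simp
  have "(\<Sum>p\<in>perms V. (f p - f (p \<circ> edge_swap e))\<^sup>2)
      \<le> (if e \<in> edge_boundary V E W then 2 * M / N else 0)" if e: "e \<in> E" for e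
  proof (cases "e \<in> edge_boundary V E W")
    case True
    obtain u v where uv: "e = {u, v}" "u \<in> V" "v \<in> V"
      using edgeE[OF e] by metis
    \<comment> \<open>If \<open>a\<close> is at neither endpoint, its position is unaffected;
      otherwise the square is at most \<open>1\<close>. Each of the two events holds for
      \<open>M / N\<close> permutations.\<close>
    have "(f p - f (p \<circ> edge_swap e))\<^sup>2 \<le> of_bool (p u = a) + of_bool (p v = a)" for p
    proof (cases "p u = a \<or> p v = a")
      case True
      then show ?thesis by (auto simp: f_def)
    next
      case False
      have "a = p (Transposition.transpose u v x) \<longleftrightarrow> a = p x" for x
        using False by (auto simp: Transposition.transpose_def)
      then have "f p = f (p \<circ> edge_swap e)"
        unfolding f_def uv(1) edge_swap_doubleton by (simp add: image_iff)
      then show ?thesis by simp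
    qed
    then have "(\<Sum>p\<in>perms V. (f p - f (p \<circ> edge_swap e))\<^sup>2)
        \<le> (\<Sum>p\<in>perms V. of_bool (p u = a) + of_bool (p v = a))"
      by (intro sum_mono)
    also have "\<dots> = 2 * M / N"
      using at uv by (simp add: sum.distrib)
    finally show ?thesis using True by simp
  next
    case False
    then have "(p \<circ> edge_swap e) ` W = p ` W" for p :: "'a \<Rightarrow> 'a"
      using edge_swap_image[OF e False W] by (metis image_comp)
    then have "f (p \<circ> edge_swap e) = f p" for p
      by (simp only: f_def)
    then show ?thesis using False by simp
  qed
  then have "(\<Sum>e\<in>E. \<Sum>p\<in>perms V. (f p - f (p \<circ> edge_swap e))\<^sup>2)
      \<le> (\<Sum>e\<in>E. if e \<in> edge_boundary V E W then 2 * M / N else 0)"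
    by (rule sum_mono)
  also have "\<dots> = card (edge_boundary V E W) * (2 * M / N)"
    using finite_E boundary_subset[of W] by (simp add: sum.If_cases Int_absorb1)
  finally have "dirichlet f \<le> card (edge_boundary V E W) * (2 * M / N) / (4 * card E)"
    unfolding dirichlet_interchange by (intro divide_right_mono) auto
  with spectral_gap_le[of f]
  have "(1 - lambda2_IP V E) * (w * M / N - (w * M / N)\<^sup>2 / M)
      \<le> card (edge_boundary V E W) * (2 * M / N) / (4 * card E)"
    unfolding lambda2_IP_def mean square M_def[symmetric] by linarith
  \<comment> \<open>The common factor \<open>M / N\<close> of variance and Dirichlet form
    cancels.\<close>
  moreover have "w * M / N - (w * M / N)\<^sup>2 / M = (w * (1 - w / N)) * (M / N)"
    using pos by (simp add: field_simps power2_eq_square)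
  ultimately have "((1 - lambda2_IP V E) * (w * (1 - w / N))) * (M / N)
      \<le> (card (edge_boundary V E W) / (2 * card E)) * (M / N)"
    by (simp add: mult_ac)
  then show ?thesis
    using pos unfolding w_def[symmetric] N_def[symmetric]
    by (simp only: mult_le_cancel_right_pos divide_pos_pos)
qed

section \<open>Foreign particles in a set and the mixing time\<close>

definition displaced :: "'a set \<Rightarrow> ('a \<Rightarrow> 'a) \<Rightarrow> real" where
  "displaced W p = card {v \<in> W. p v \<notin> W}"

text \<open>A swap along a boundary edge changes the particle at one site of \<open>W\<close> only;
  any other swap merely permutes the sites of \<open>W\<close>.\<close>

lemma displaced_edge_swap:
  assumes e: "e \<in> E" and W: "W \<subseteq> V"
  shows "displaced W (p \<circ> edge_swap e) \<le> displaced W p + of_bool (e \<in> edge_boundary V E W)"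
proof (cases "e \<in> edge_boundary V E W")
  case True
  then obtain u v where uv: "e = {u, v}" "u \<in> W" "v \<notin> W"
    by (auto simp: edge_boundary_def)
  have fin: "finite {x \<in> W. p x \<notin> W}"
    using finite_subset[OF W finite_V] by simp
  have "{x \<in> W. (p \<circ> edge_swap e) x \<notin> W} \<subseteq> insert u {x \<in> W. p x \<notin> W}"
    using uv by (auto simp: edge_swap_doubleton Transposition.transpose_def split: if_splits)
  then have "card {x \<in> W. (p \<circ> edge_swap e) x \<notin> W} \<le> card (insert u {x \<in> W. p x \<notin> W})"
    using fin by (intro card_mono) auto
  also have "\<dots> \<le> Suc (card {x \<in> W. p x \<notin> W})"
    using fin by (simp add: card_insert_if)
  finally show ?thesis using True by (simp add: displaced_def)
next
  case False
  have im: "edge_swap e ` W = W"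
    by (rule edge_swap_image[OF e False W])
  have inv: "edge_swap e (edge_swap e x) = x" for x
    using edge_swap_involutory[OF e] by (metis comp_apply id_apply)
  have "card {x \<in> W. (p \<circ> edge_swap e) x \<notin> W} = card {x \<in> W. p x \<notin> W}"
    by (rule bij_betw_same_card[of "edge_swap e"], rule bij_betw_byWitness[where f'="edge_swap e"])
      (use im inv in auto)
  then show ?thesis using False by (simp add: displaced_def)
qed

text \<open>Under \<open>id\<close> every label sits at its own vertex, so the count starts at
  \<open>0\<close>. A step picks a boundary edge with probability
  \<open>card (edge_boundary V E W) / (2 * card E)\<close>, and only then can the count grow, by at
  most one.\<close>

lemma expectation_displaced_le:
  assumes W: "W \<subseteq> V"
  shows "measure_pmf.expectation (chain_law (interchange_step E) t id) (displaced W)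
    \<le> t * (card (edge_boundary V E W) / (2 * card E))"
proof (induction t)
  case 0
  show ?case by (simp add: displaced_def)
next
  case (Suc t)
  let ?b = "card (edge_boundary V E W) / (2 * card E)"
  let ?q = "pmf (chain_law (interchange_step E) t id)"
  have id: "id \<in> perms V" by (simp add: perms_def permutes_id)
  have step: "measure_pmf.expectation (interchange_step E p) (displaced W) \<le> displaced W p + ?b" for p
  proof -
    have "(\<Sum>e\<in>E. displaced W (p \<circ> edge_swap e))
        \<le> (\<Sum>e\<in>E. displaced W p + of_bool (e \<in> edge_boundary V E W))"
      by (intro sum_mono displaced_edge_swap W)
    also have "\<dots> = card E * displaced W p + card (edge_boundary V E W)"
      using finite_E boundary_subset[of W] by (simp add: sum.distrib Int_absorb1)
    finally have "(\<Sum>e\<in>E. displaced W (p \<circ> edge_swap e)) / (2 * card E)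
        \<le> (card E * displaced W p + card (edge_boundary V E W)) / (2 * card E)"
      by (rule divide_right_mono) simp
    then show ?thesis
      using card_E_pos unfolding expectation_step by (simp add: add_divide_distrib)
  qed
  have "measure_pmf.expectation (chain_law (interchange_step E) (Suc t) id) (displaced W)
      \<le> (\<Sum>p\<in>perms V. ?q p * (displaced W p + ?b))"
    unfolding expectation_law_Suc[OF id] by (intro sum_mono mult_left_mono step) auto
  also have "\<dots> = (\<Sum>p\<in>perms V. displaced W p * ?q p) + (\<Sum>p\<in>perms V. ?q p) * ?b"
    unfolding sum_distrib_right by (simp add: distrib_left sum.distrib mult.commute)
  also have "(\<Sum>p\<in>perms V. ?q p) = 1"
    by (intro sum_pmf_eq_1 finite_perms law_closed id)
  also have "(\<Sum>p\<in>perms V. displaced W p * ?q p)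
      = measure_pmf.expectation (chain_law (interchange_step E) t id) (displaced W)"
    using law_closed[OF id] finite_perms by (subst integral_measure_pmf_real[of "perms V"]) auto
  finally show ?case
    using Suc.IH by (simp only: of_nat_Suc distrib_right mult_1 add.commute)
qed

text \<open>Sum over pairs of a site in \<open>W\<close> and a label outside \<open>W\<close>; each
  pair is realised by a fraction \<open>1 / card V\<close> of the permutations.\<close>

lemma sum_displaced:
  assumes W: "W \<subseteq> V"
  shows "(\<Sum>p\<in>perms V. displaced W p) = card (perms V) * (card W * (1 - card W / card V))"
proof -
  have fin: "finite W" using W finite_V finite_subset by blast
  have "displaced W p = (\<Sum>v\<in>W. \<Sum>a\<in>V - W. of_bool (p v = a))" if p: "p \<in> perms V" for p
  proof -
    have "(\<Sum>a\<in>V - W. of_bool (p v = a)) = (of_bool (p v \<notin> W) :: real)" if "v \<in> W" for v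
    proof -
      have "p v \<in> V" using p that W by (auto simp: perms_def permutes_in_image)
      then show ?thesis using finite_V by (simp add: of_bool_def sum.delta)
    qed
    then have "(\<Sum>v\<in>W. \<Sum>a\<in>V - W. of_bool (p v = a)) = (\<Sum>v\<in>W. of_bool (p v \<notin> W) :: real)"
      by (intro sum.cong) auto
    also have "\<dots> = displaced W p"
      using fin by (simp add: displaced_def Int_def)
    finally show ?thesis by simp
  qed
  then have "(\<Sum>p\<in>perms V. displaced W p)
      = (\<Sum>p\<in>perms V. \<Sum>v\<in>W. \<Sum>a\<in>V - W. of_bool (p v = a))"
    by simp
  also have "\<dots> = (\<Sum>v\<in>W. \<Sum>a\<in>V - W. \<Sum>p\<in>perms V. of_bool (p v = a))"
    by (subst sum.swap) (intro sum.cong refl sum.swap)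
  also have "\<dots> = (\<Sum>v\<in>W. \<Sum>a\<in>V - W. card (perms V) / card V)"
    using card_perms_at W finite_perms by (intro sum.cong refl) (auto simp: Int_def subset_iff)
  also have "\<dots> = card W * (real (card (V - W)) * (card (perms V) / card V))"
    by simp
  also have "real (card (V - W)) = real (card V) - real (card W)"
    using W fin finite_V by (simp add: card_Diff_subset card_mono of_nat_diff)
  finally show ?thesis
    using two_vertices by (simp add: field_simps)
qed

text \<open>At the mixing time the event \<open>A\<close> must be nearly as likely as under the
  uniform law, whereas the drift bound limits the mean of the count.\<close>

theorem card_less_boundary:
  assumes W: "W \<subseteq> V" and half: "2 * card W < card V" and ne: "W \<noteq> {}"
  shows "real (card W) * card E < 24 * t_mix_IP V E * card (edge_boundary V E W)"
proof -
  define w where "w = real (card W)"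
  define A where "A = {p. w / 4 \<le> displaced W p}"
  define \<mu> where "\<mu> = chain_law (interchange_step E) (t_mix_IP V E) id"
  define \<pi> where "\<pi> = pmf_of_set (perms V)"
  have fin: "finite W" using W finite_V finite_subset by blast
  have id: "id \<in> perms V" by (simp add: perms_def permutes_id)
  have w: "0 < w" using ne fin by (simp add: w_def card_gt_0_iff)
  have M: "0 < real (card (perms V))" by (simp add: card_perms)
  have le_w: "displaced W p \<le> w" for p
    unfolding displaced_def w_def using fin by (simp add: card_mono)
  have \<mu>: "set_pmf \<mu> \<subseteq> perms V" unfolding \<mu>_def by (rule law_closed[OF id])
  have prob_\<pi>: "measure_pmf.prob \<pi> A > 1 / 3"
  proof -
    \<comment> \<open>The count is below \<open>w / 4\<close> off \<open>A\<close> and at most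
      \<open>w\<close> on it. Its uniform mean exceeds \<open>w / 2\<close> as \<open>W\<close> has
      less than half the vertices, which forces probability above \<open>1 / 3\<close>.\<close>
    have "(\<Sum>p\<in>perms V. displaced W p) \<le> (\<Sum>p\<in>perms V. w / 4 + 3 / 4 * w * of_bool (p \<in> A))"
      using le_w w by (intro sum_mono) (auto simp: A_def)
    also have "\<dots> = card (perms V) * (w / 4) + 3 / 4 * w * card (perms V \<inter> A)"
      using finite_perms by (simp add: sum.distrib flip: sum_distrib_left sum_divide_distrib)
    also have "\<dots> = card (perms V) * (w * (1 / 4 + 3 / 4 * measure_pmf.prob \<pi> A))"
    proof -
      have "real (card (perms V \<inter> A)) = card (perms V) * measure_pmf.prob \<pi> A"
        using M unfolding \<pi>_def by (simp add: measure_pmf_of_set[OF states_ne finite_perms])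
      then show ?thesis by (simp add: algebra_simps)
    qed
    finally have "w * (1 - w / card V) \<le> w * (1 / 4 + 3 / 4 * measure_pmf.prob \<pi> A)"
      unfolding sum_displaced[OF W] w_def[symmetric] using M by (simp only: mult_le_cancel_left_pos)
    then have "1 - w / card V \<le> 1 / 4 + 3 / 4 * measure_pmf.prob \<pi> A"
      using w by (simp only: mult_le_cancel_left_pos)
    moreover have "w / card V < 1 / 2"
      using half two_vertices by (simp add: w_def field_simps)
    ultimately show ?thesis by simp
  qed
  have "tv_dist \<mu> \<pi> \<le> worst_tv (perms V) (interchange_step E) \<pi> (t_mix_IP V E)"
    unfolding worst_tv_def \<mu>_def using finite_perms id by (intro Max_ge) auto
  also have "\<dots> < 1 / 4"
    using mixing_time_doeblin(3)[of "1 / 4"] by (simp add: \<pi>_def t_mix_IP_def)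
  \<comment> \<open>Here \<open>1 / 12 = 1 / 3 - 1 / 4\<close>. Markov's inequality then bounds the
    mean below by \<open>w / 48\<close>, and the \<open>2\<close> in the drift bound turns
    \<open>48\<close> into the final \<open>24\<close>.\<close>
  finally have "1 / 12 < measure_pmf.prob \<mu> A"
    using prob_diff_le_tv_dist[of \<mu> A \<pi>] prob_\<pi> by linarith
  then have "w / 48 < w / 4 * measure_pmf.prob \<mu> A"
    using w by (simp add: field_simps)
  also have "\<dots> = measure_pmf.expectation \<mu> (\<lambda>p. w / 4 * indicat_real A p)"
    by simp
  also have "\<dots> \<le> measure_pmf.expectation \<mu> (displaced W)"
    using finite_subset[OF \<mu> finite_perms]
    by (intro integral_mono integrable_measure_pmf_finite)
      (auto simp: A_def displaced_def indicator_def)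
  also have "\<dots> \<le> t_mix_IP V E * (card (edge_boundary V E W) / (2 * card E))"
    unfolding \<mu>_def by (rule expectation_displaced_le[OF W])
  finally show ?thesis
    using card_E_pos by (simp add: w_def field_simps)
qed

end

section \<open>Small sets and large sets\<close>

context interchange_graph
begin

lemma t_mix_pos: "0 < t_mix_IP V E"
  unfolding t_mix_IP_def by (rule mixing_time_doeblin) simp

lemma t_mix_le: "t_mix_IP V E \<le> doeblin_time (1 / 2 ^ Suc (card V)) (fact (card V)) (1 / 4)"
  using mixing_time_doeblin(2)[of "1 / 4"] by (simp add: t_mix_IP_def card_perms)

text \<open>For a singleton the boundary bound has right side at most \<open>1 / 2\<close>, while
  \<open>1 - 1 / card V\<close> is at least \<open>1 / 2\<close>.\<close>

lemma spectral_gap_le_1: "1 - lambda2_IP V E \<le> 1"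
proof (rule ccontr)
  assume "\<not> ?thesis"
  then have gap: "1 < 1 - lambda2_IP V E" by simp
  obtain v where v: "v \<in> V" using two_vertices by fastforce
  have "1 / 2 \<le> 1 - 1 / real (card V)"
    using two_vertices by (simp add: field_simps)
  also have "\<dots> = 1 * (1 - 1 / real (card V))" by simp
  also have "\<dots> < (1 - lambda2_IP V E) * (1 - 1 / card V)"
    using two_vertices by (intro mult_strict_right_mono gap) simp
  also have "\<dots> \<le> card (edge_boundary V E {v}) / (2 * card E)"
    using spectral_gap_le_boundary[of "{v}"] v by simp
  also have "\<dots> \<le> card E / (2 * card E)"
    using card_mono[OF finite_E boundary_subset[of "{v}"]] by (intro divide_right_mono) auto
  finally show False using card_E_pos by simp
qed

text \<open>A proper subset has \<open>card V \<ge> card W + 1\<close>, so the variance factor is at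
  least \<open>1 / (K + 1)\<close>; the boundary hypothesis then makes the gap
  \<open>O(1 / t)\<close>.\<close>

lemma spectral_gap_small_set:
  assumes W: "W \<subset> V" "W \<noteq> {}" and K: "real (card W) \<le> K"
    and bd: "real (card (edge_boundary V E W)) \<le> K * card E / t_mix_IP V E"
  shows "(1 - lambda2_IP V E) * t_mix_IP V E \<le> K * (K + 1) / 2"
\<comment> \<open>The inequalities are multiplied by the gap; were it negative, the left side would
  be at most \<open>0\<close> anyway.\<close>
proof (cases "0 \<le> 1 - lambda2_IP V E")
  case True
  define g where "g = 1 - lambda2_IP V E"
  define t where "t = real (t_mix_IP V E)"
  define w where "w = real (card W)"
  have t: "0 < t" using t_mix_pos by (simp add: t_def)
  have "finite W" using W finite_V finite_subset by blast
  then have w: "1 \<le> w" using W(2) by (simp add: w_def Suc_le_eq card_gt_0_iff)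
  have "Suc (card W) \<le> card V"
    using psubset_card_mono[OF finite_V W(1)] by simp
  then have "w + 1 \<le> card V" by (simp add: w_def)
  then have "w / card V \<le> w / (w + 1)"
    using w by (intro divide_left_mono) auto
  then have "1 / (w + 1) \<le> 1 - w / card V"
    using w by (simp add: field_simps)
  moreover have "1 / (K + 1) \<le> 1 / (w + 1)"
    using w K by (intro divide_left_mono) (auto simp: w_def)
  ultimately have "1 * (1 / (K + 1)) \<le> w * (1 - w / card V)"
    using w K by (intro mult_mono) (auto simp: w_def)
  then have "g * (1 / (K + 1)) \<le> g * (w * (1 - w / card V))"
    using True by (intro mult_left_mono) (auto simp: g_def)
  also have "\<dots> \<le> card (edge_boundary V E W) / (2 * card E)"
    using spectral_gap_le_boundary[of W] W by (auto simp: g_def w_def)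
  also have "\<dots> \<le> (K * card E / t) / (2 * card E)"
    using bd by (intro divide_right_mono) (auto simp: t_def)
  also have "\<dots> = K / (2 * t)"
    using card_E_pos by simp
  finally have "g / (K + 1) \<le> K / (2 * t)" by simp
  then have "g * t \<le> K * (K + 1) / 2"
    using t w K by (simp add: field_simps w_def)
  then show ?thesis by (simp add: g_def t_def)
next
  case False
  then have "(1 - lambda2_IP V E) * t_mix_IP V E \<le> 0"
    by (intro mult_nonpos_nonneg) auto
  also have "0 \<le> K * (K + 1) / 2"
    using K by (simp add: order_trans[OF of_nat_0_le_iff])
  finally show ?thesis .
qed

end

theorem proposition2p1:
  fixes V :: "nat \<Rightarrow> 'a set" and E :: "nat \<Rightarrow> 'a set set"
  assumes "\<And>n. simple_graph (V n) (E n)"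
    and "\<And>n. connected_graph (V n) (E n)"
    and "\<And>n. 2 \<le> card (V n)"
  shows "((\<exists>K::real. \<forall>\<^sub>F n in sequentially. \<exists>W \<subseteq> V n.
             1 \<le> card W \<and> real (card W) \<le> K \<and>
             real (card (edge_boundary (V n) (E n) W))
               \<le> K * real (card (E n)) / real (t_mix_IP (V n) (E n)))
          \<longrightarrow> \<not> product_condition V E)
       \<and> \<not> (\<exists>W :: nat \<Rightarrow> 'a set.
             (\<forall>n. W n \<subseteq> V n) \<and>
             filterlim (\<lambda>n. card (W n)) at_top sequentially \<and>
             (\<forall>n. real (card (W n)) < real (card (V n)) / 2) \<and>
             (\<exists>C::real. \<forall>n. real (card (edge_boundary (V n) (E n) (W n)))
               \<le> C * real (card (E n)) / real (t_mix_IP (V n) (E n))))"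
proof (intro conjI impI)
  have graph: "interchange_graph (V n) (E n)" for n
    using assms by unfold_locales
  assume "\<exists>K::real. \<forall>\<^sub>F n in sequentially. \<exists>W \<subseteq> V n.
             1 \<le> card W \<and> real (card W) \<le> K \<and>
             real (card (edge_boundary (V n) (E n) W))
               \<le> K * real (card (E n)) / real (t_mix_IP (V n) (E n))"
  then obtain K :: real where K: "\<forall>\<^sub>F n in sequentially. \<exists>W \<subseteq> V n.
             1 \<le> card W \<and> real (card W) \<le> K \<and>
             real (card (edge_boundary (V n) (E n) W))
               \<le> K * real (card (E n)) / real (t_mix_IP (V n) (E n))" ..
  \<comment> \<open>A bound on the mixing times of all graphs with at most \<open>K\<close> vertices covers the case \<open>W = V n\<close>,
    in which the boundary carries no information.\<close>
  define T where "T = Max ((\<lambda>N. doeblin_time (1 / 2 ^ Suc N) (fact N) (1 / 4)) ` {..nat \<lceil>K\<rceil>})"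
  define B where "B = max (K * (K + 1) / 2) (real T)"
  have "\<forall>\<^sub>F n in sequentially. (1 - lambda2_IP (V n) (E n)) * t_mix_IP (V n) (E n) \<le> B"
    using K
  proof eventually_elim
    case (elim n)
    interpret interchange_graph "V n" "E n" by (rule graph)
    obtain W where W: "W \<subseteq> V n" "1 \<le> card W" "real (card W) \<le> K"
      and bd: "real (card (edge_boundary (V n) (E n) W))
               \<le> K * real (card (E n)) / real (t_mix_IP (V n) (E n))"
      using elim by blast
    show ?case
    proof (cases "W = V n")
      case True
      then have "card (V n) \<le> nat \<lceil>K\<rceil>"
        using W(3) by (simp add: le_nat_iff le_ceiling_iff)
      then have "doeblin_time (1 / 2 ^ Suc (card (V n))) (fact (card (V n))) (1 / 4) \<le> T"
        unfolding T_def by (intro Max_ge) auto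
      then have "t_mix_IP (V n) (E n) \<le> T" using t_mix_le by linarith
      moreover have "(1 - lambda2_IP (V n) (E n)) * t_mix_IP (V n) (E n) \<le> 1 * real (t_mix_IP (V n) (E n))"
        by (intro mult_right_mono spectral_gap_le_1) simp
      ultimately show ?thesis by (simp add: B_def)
    next
      case False
      then have "(1 - lambda2_IP (V n) (E n)) * t_mix_IP (V n) (E n) \<le> K * (K + 1) / 2"
        using W bd by (intro spectral_gap_small_set[of W]) auto
      then show ?thesis by (simp add: B_def)
    qed
  qed
  \<comment> \<open>Two eventual properties hold jointly at some index, so the product cannot also
    exceed \<open>B\<close> eventually.\<close>
  then have bounded: "\<not> (\<forall>\<^sub>F n in sequentially. B < (1 - lambda2_IP (V n) (E n)) * t_mix_IP (V n) (E n))"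
    by (metis (mono_tags, lifting) eventually_sequentially linorder_not_less nat_le_linear)
  show "\<not> product_condition V E"
    using bounded unfolding product_condition_def filterlim_at_top_dense by blast
next
  have graph: "interchange_graph (V n) (E n)" for n
    using assms by unfold_locales
  show "\<not> (\<exists>W :: nat \<Rightarrow> 'a set.
             (\<forall>n. W n \<subseteq> V n) \<and>
             filterlim (\<lambda>n. card (W n)) at_top sequentially \<and>
             (\<forall>n. real (card (W n)) < real (card (V n)) / 2) \<and>
             (\<exists>C::real. \<forall>n. real (card (edge_boundary (V n) (E n) (W n)))
               \<le> C * real (card (E n)) / real (t_mix_IP (V n) (E n))))"
  proof
    assume "\<exists>W :: nat \<Rightarrow> 'a set.
             (\<forall>n. W n \<subseteq> V n) \<and>
             filterlim (\<lambda>n. card (W n)) at_top sequentially \<and>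
             (\<forall>n. real (card (W n)) < real (card (V n)) / 2) \<and>
             (\<exists>C::real. \<forall>n. real (card (edge_boundary (V n) (E n) (W n)))
               \<le> C * real (card (E n)) / real (t_mix_IP (V n) (E n)))"
    then obtain W C where W: "\<And>n. W n \<subseteq> V n"
      and lim: "filterlim (\<lambda>n. card (W n)) at_top sequentially"
      and half: "\<And>n. real (card (W n)) < real (card (V n)) / 2"
      and bd: "\<And>n. real (card (edge_boundary (V n) (E n) (W n)))
               \<le> C * real (card (E n)) / real (t_mix_IP (V n) (E n))"
      by blast
    \<comment> \<open>A single index contradicts the bound \<open>card (W n) < 24 * C\<close>
      derived below; the \<open>1\<close> keeps \<open>W n\<close> nonempty.\<close>
    have "\<forall>\<^sub>F n in sequentially. max 1 (nat \<lceil>24 * C\<rceil>) \<le> card (W n)"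
      using lim by (simp only: filterlim_at_top)
    then obtain n where n: "1 \<le> card (W n)" "nat \<lceil>24 * C\<rceil> \<le> card (W n)"
      by (auto simp: eventually_sequentially)
    interpret interchange_graph "V n" "E n" by (rule graph)
    have "2 * card (W n) < card (V n)" using half[of n] by linarith
    then have "real (card (W n)) * card (E n)
        < 24 * real (t_mix_IP (V n) (E n)) * card (edge_boundary (V n) (E n) (W n))"
      using card_less_boundary[OF W] n(1) by fastforce
    also have "\<dots> \<le> 24 * real (t_mix_IP (V n) (E n)) * (C * card (E n) / t_mix_IP (V n) (E n))"
      by (intro mult_left_mono bd) simp
    also have "\<dots> = 24 * C * card (E n)"
      using t_mix_pos by simp
    finally have "real (card (W n)) < 24 * C"
      using card_E_pos by simp
    then show False using n(2) by linarith
  qed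
qed

end
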